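(* The bicyclic semigroup $\mathcal C(p,q)$ is (algebraically isomorphic to) a subsemigroup of some Tychonoff countably pracompact topological semigroup.
   Context: The bicyclic semigroup $\mathcal C(p,q)$ is the semigroup with identity generated by $p,q$ subject to the single relation $qp=1$. A space $X$ is countably pracompact if there is a dense subset $A\subset X$ such that every infinite subset of $A$ has an accumulation point in $X$. A topological semigroup is a Hausdorff space with a jointly continuous associative operation. *)

theory Defs
  imports "HOL-Analysis.Analysis"
begin

text \<open>The bicyclic semigroup C(p,q): every element has the unique normal form
  p^i q^j (since qp = 1), represented by the pair (i,j).  Then
  (p^a q^b)(p^c q^d) = p^(a + c - min b c) q^(b + d - min b c).\<close>

type_synonym bicyclic = "nat \<times> nat"

definition bicyclic_mult :: "bicyclic \<Rightarrow> bicyclic \<Rightarrow> bicyclic" where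
  "bicyclic_mult x y =
     (case x of (a, b) \<Rightarrow> case y of (c, d) \<Rightarrow>
        (a + c - min b c, b + d - min b c))"

definition bicyclic_p :: bicyclic where "bicyclic_p = (1, 0)"
definition bicyclic_q :: bicyclic where "bicyclic_q = (0, 1)"

definition topological_semigroup :: "'a topology \<Rightarrow> ('a \<Rightarrow> 'a \<Rightarrow> 'a) \<Rightarrow> bool" where
  "topological_semigroup X m \<longleftrightarrow>
     Hausdorff_space X \<and>
     (\<forall>x\<in>topspace X. \<forall>y\<in>topspace X. m x y \<in> topspace X) \<and>
     (\<forall>x\<in>topspace X. \<forall>y\<in>topspace X. \<forall>z\<in>topspace X. m (m x y) z = m x (m y z)) \<and>
     continuous_map (prod_topology X X) X (\<lambda>(x, y). m x y)"

definition Tychonoff_space :: "'a topology \<Rightarrow> bool" where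
  "Tychonoff_space X \<longleftrightarrow> Hausdorff_space X \<and> completely_regular_space X"

definition countably_pracompact :: "'a topology \<Rightarrow> bool" where
  "countably_pracompact X \<longleftrightarrow>
     (\<exists>A. A \<subseteq> topspace X \<and> X closure_of A = topspace X \<and>
          (\<forall>B. B \<subseteq> A \<and> infinite B \<longrightarrow> X derived_set_of B \<noteq> {}))"

end

(* Writing x for p^i q^j, the map x |-> i - j is a homomorphism onto Z. Glue to the discrete
   bicyclic semigroup a copy of Z and a set T of accumulation points of Z in the group of all
   functions from the reals to the circle, an integer z being the character
   theta |-> exp(i z theta). A neighbourhood of z consists of z and the p^i q^j with i - j = z
   and i, j large; a neighbourhood of t in T is pulled back along the homomorphism. Every
   infinite set of bicyclic elements accumulates, at z if i - j = z infinitely often and in T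
   otherwise. Multiplication is continuous provided that the union of Z and T is a semigroup
   in which T is an ideal disjoint from Z; otherwise q^n p^n = 1 would contradict continuity, as q^n and p^n
   accumulate in T.

   T is generated by one accumulation point of every infinite set B of integers, chosen by
   recursion over a well-ordering of these sets so that no nonempty product of the points
   chosen is an integer. At each stage at most continuum many equations must be avoided, and
   this is possible because, along a lacunary sequence in B, an independent family of continuum
   many sets yields continuum many angles at which the sign of the real part of the
   accumulation point can be prescribed. *)
theory Submission
  imports Defs
begin

section \<open>Extending the bicyclic semigroup\<close>

lemma bicyclic_mult_diff:
  "int (fst (bicyclic_mult (a, b) (c, d))) - int (snd (bicyclic_mult (a, b) (c, d)))
     = (int a - int b) + (int c - int d)"
  unfolding bicyclic_mult_def by (auto simp: min_def)

lemma bicyclic_mult_assoc: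
  "bicyclic_mult (bicyclic_mult x y) z = bicyclic_mult x (bicyclic_mult y z)"
  unfolding bicyclic_mult_def by (auto split: prod.split simp: min_def)

text \<open>What the gluing uses of the ambient semigroup. The instance will consist of all
  functions from \<open>real\<close> to \<open>complex\<close> under the pointwise product, not only
  circle-valued ones, so no inverses are assumed.\<close>

locale bicyclic_extension =
  fixes K :: "'k topology" and mul :: "'k \<Rightarrow> 'k \<Rightarrow> 'k" (infixl "\<cdot>" 70)
    and e :: "int \<Rightarrow> 'k" and T :: "'k set"
  assumes Hausdorff_K: "Hausdorff_space K"
    and completely_regular_K: "completely_regular_space K"
    and continuous_mul: "continuous_map (prod_topology K K) K (\<lambda>(x, y). x \<cdot> y)"
    and mul_assoc: "x \<cdot> y \<cdot> z = x \<cdot> (y \<cdot> z)"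
    and mul_commute: "x \<cdot> y = y \<cdot> x"
    and inj_e: "inj e"
    and e_in_K: "e i \<in> topspace K"
    and e_add: "e (i + j) = e i \<cdot> e j"
    and T_mul_T: "\<lbrakk>s \<in> T; t \<in> T\<rbrakk> \<Longrightarrow> s \<cdot> t \<in> T"
    and e_mul_T: "t \<in> T \<Longrightarrow> e i \<cdot> t \<in> T"
    and e_notin_T: "e i \<notin> T"
    and T_subset_closure: "T \<subseteq> K closure_of range e"
    and accumulation_in_T: "infinite B \<Longrightarrow> T \<inter> K derived_set_of (e ` B) \<noteq> {}"
begin

section \<open>The extended semigroup and its topology\<close>

lemma T_subset: "T \<subseteq> topspace K"
  using T_subset_closure closure_of_subset_topspace by (rule subset_trans)

lemma T_mul_e: "t \<in> T \<Longrightarrow> t \<cdot> e i \<in> T"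
  by (subst mul_commute) (rule e_mul_T)

definition carr :: "(bicyclic + 'k) set" where
  "carr = range Inl \<union> Inr ` (range e \<union> T)"

text \<open>Extends the homomorphism by the identity on the glued points, so that mixed products and
  the neighbourhoods of \<open>T\<close> can be read off in \<open>K\<close>.\<close>

fun val :: "bicyclic + 'k \<Rightarrow> 'k" where
  "val (Inl (i, j)) = e (int i - int j)"
| "val (Inr t) = t"

fun xmul :: "bicyclic + 'k \<Rightarrow> bicyclic + 'k \<Rightarrow> bicyclic + 'k" where
  "xmul (Inl c) (Inl d) = Inl (bicyclic_mult c d)"
| "xmul x y = Inr (val x \<cdot> val y)"

definition tail :: "int \<Rightarrow> nat \<Rightarrow> (bicyclic + 'k) set" where
  "tail z n = insert (Inr (e z)) {Inl (i, j) |i j. n \<le> i \<and> n \<le> j \<and> int i - int j = z}"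

text \<open>No clause concerns the points \<open>Inl c\<close>, which makes them isolated.\<close>

definition xopen :: "(bicyclic + 'k) set \<Rightarrow> bool" where
  "xopen W \<longleftrightarrow> W \<subseteq> carr \<and>
     (\<forall>z. Inr (e z) \<in> W \<longrightarrow> (\<exists>n. tail z n \<subseteq> W)) \<and>
     (\<forall>t\<in>T. Inr t \<in> W \<longrightarrow> (\<exists>U. openin K U \<and> t \<in> U \<and> carr \<inter> val -` U \<subseteq> W))"

definition xtop :: "(bicyclic + 'k) topology" where
  "xtop = topology xopen"

lemma tail_antimono: "m \<le> n \<Longrightarrow> tail z n \<subseteq> tail z m"
  unfolding tail_def by auto

lemma xopen_subset: "xopen W \<Longrightarrow> W \<subseteq> carr"
  unfolding xopen_def by (rule conjunct1)

lemma xopen_tail_subset: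
  assumes "xopen W" "Inr (e z) \<in> W"
  obtains n where "tail z n \<subseteq> W"
  using assms unfolding xopen_def by metis

lemma xopen_vimage_subset:
  assumes "xopen W" "Inr t \<in> W" "t \<in> T"
  obtains U where "openin K U" "t \<in> U" "carr \<inter> val -` U \<subseteq> W"
  using assms unfolding xopen_def by metis

lemma openin_xtop: "openin xtop = xopen"
proof -
  have "xopen (S \<inter> S')" if S: "xopen S" and S': "xopen S'" for S S'
    unfolding xopen_def
  proof (intro conjI allI impI ballI)
    show "S \<inter> S' \<subseteq> carr" using xopen_subset[OF S] by blast
  next
    fix z assume "Inr (e z) \<in> S \<inter> S'"
    then obtain n n' where "tail z n \<subseteq> S" "tail z n' \<subseteq> S'"
      using S S' by (metis IntE xopen_tail_subset)
    then have "tail z (max n n') \<subseteq> S \<inter> S'"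
      using tail_antimono[of n "max n n'" z] tail_antimono[of n' "max n n'" z] by auto
    then show "\<exists>n. tail z n \<subseteq> S \<inter> S'" ..
  next
    fix t assume "t \<in> T" "Inr t \<in> S \<inter> S'"
    then obtain U U' where "openin K U" "t \<in> U" "carr \<inter> val -` U \<subseteq> S"
        and "openin K U'" "t \<in> U'" "carr \<inter> val -` U' \<subseteq> S'"
      using S S' by (metis IntE xopen_vimage_subset)
    then show "\<exists>U. openin K U \<and> t \<in> U \<and> carr \<inter> val -` U \<subseteq> S \<inter> S'"
      by (intro exI[of _ "U \<inter> U'"]) auto
  qed
  moreover have "xopen (\<Union>\<S>)" if \<S>: "\<forall>S\<in>\<S>. xopen S" for \<S>
    unfolding xopen_def
  proof (intro conjI allI impI ballI)
    show "\<Union>\<S> \<subseteq> carr" using \<S> xopen_subset by blast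
    show "\<exists>n. tail z n \<subseteq> \<Union>\<S>" if z: "Inr (e z) \<in> \<Union>\<S>" for z
    proof -
      obtain S where "S \<in> \<S>" "Inr (e z) \<in> S" using z by blast
      then obtain n where "tail z n \<subseteq> S" using \<S> xopen_tail_subset[of S z] by auto
      then show ?thesis using \<open>S \<in> \<S>\<close> by blast
    qed
    show "\<exists>U. openin K U \<and> t \<in> U \<and> carr \<inter> val -` U \<subseteq> \<Union>\<S>"
      if t: "t \<in> T" "Inr t \<in> \<Union>\<S>" for t
    proof -
      obtain S where "S \<in> \<S>" "Inr t \<in> S" using t(2) by blast
      then obtain U where "openin K U" "t \<in> U" "carr \<inter> val -` U \<subseteq> S"
        using \<S> t(1) xopen_vimage_subset[of S t] by auto
      then show ?thesis using \<open>S \<in> \<S>\<close> by blast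
    qed
  qed
  ultimately have "istopology xopen" unfolding istopology_def by blast
  then show ?thesis unfolding xtop_def by (rule topology_inverse')
qed

lemma xopen_tail: "xopen (tail z n)"
  unfolding xopen_def
proof (intro conjI allI impI ballI)
  show "tail z n \<subseteq> carr" unfolding tail_def carr_def by auto
  show "\<exists>m. tail w m \<subseteq> tail z n" if "Inr (e w) \<in> tail z n" for w
    using that injD[OF inj_e] unfolding tail_def by auto
  \<comment> \<open>Vacuous: the only \<open>Inr\<close> point of a tail is an integer, and
    \<open>T\<close> contains none.\<close>
  show "\<exists>U. openin K U \<and> t \<in> U \<and> carr \<inter> val -` U \<subseteq> tail z n"
    if "t \<in> T" "Inr t \<in> tail z n" for t
    using that e_notin_T unfolding tail_def by auto
qed

lemma xopen_Inl: "xopen {Inl c}"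
  unfolding xopen_def carr_def by auto

lemma val_in_K: "x \<in> carr \<Longrightarrow> val x \<in> topspace K"
  unfolding carr_def using T_subset e_in_K by auto

lemma xopen_vimage:
  assumes "openin K U"
  shows "xopen (carr \<inter> val -` U)"
  unfolding xopen_def
proof (intro conjI allI impI ballI)
  \<comment> \<open>Already \<open>n = 0\<close> works, since \<open>val\<close> is constant on
    \<open>tail z 0\<close>.\<close>
  show "\<exists>n. tail z n \<subseteq> carr \<inter> val -` U" if "Inr (e z) \<in> carr \<inter> val -` U" for z
    using that unfolding tail_def carr_def by (intro exI[of _ 0]) auto
qed (use assms in auto)

lemma carr_cases [consumes 1, case_names bicyclic int T]:
  assumes "x \<in> carr"
  obtains i j where "x = Inl (i, j)" | z where "x = Inr (e z)" | t where "x = Inr t" "t \<in> T"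
  using assms unfolding carr_def by auto

lemma topspace_xtop: "topspace xtop = carr"
proof
  show "topspace xtop \<subseteq> carr"
    using openin_topspace[of xtop] unfolding openin_xtop xopen_def by blast
  have "xopen carr" using xopen_vimage[OF openin_topspace] val_in_K
    by (metis Int_absorb2 subsetI vimageI)
  then show "carr \<subseteq> topspace xtop"
    using openin_subset[of xtop] openin_xtop by auto
qed

lemma continuous_val: "continuous_map xtop K val"
  unfolding continuous_map_def topspace_xtop openin_xtop
  using val_in_K xopen_vimage by (auto simp: Collect_conj_eq vimage_def)

section \<open>The multiplication: algebra and joint continuity\<close>

lemma xmul_in_carr:
  assumes "x \<in> carr" "y \<in> carr"
  shows "xmul x y \<in> carr"
  using assms by (elim carr_cases)
    (auto simp: carr_def T_mul_T e_mul_T T_mul_e simp flip: e_add)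

lemma val_xmul: "val (xmul x y) = val x \<cdot> val y"
proof (cases "(x, y)" rule: xmul.cases)
  case (1 c d)
  obtain a b c' d' where "c = (a, b)" "d = (c', d')" by fastforce
  moreover obtain i j where "bicyclic_mult (a, b) (c', d') = (i, j)" by fastforce
  ultimately show ?thesis
    using 1 bicyclic_mult_diff[of a b c' d'] by (simp flip: e_add)
qed auto

text \<open>As soon as one factor lies in the right summand, so do both bracketings, and there
  \<open>val\<close> is injective; associativity in \<open>K\<close> then settles the
  matter.\<close>

lemma xmul_assoc: "xmul (xmul x y) z = xmul x (xmul y z)"
proof (cases "isl x \<and> isl y \<and> isl z")
  case True
  then show ?thesis by (auto simp: isl_def bicyclic_mult_assoc)
next
  case False
  then have "\<not> isl (xmul (xmul x y) z)" "\<not> isl (xmul x (xmul y z))"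
    by (cases x; cases y; cases z; simp)+
  moreover have "val (xmul (xmul x y) z) = val (xmul x (xmul y z))"
    by (simp add: val_xmul mul_assoc)
  ultimately show ?thesis
    by (cases "xmul (xmul x y) z"; cases "xmul x (xmul y z)") auto
qed

text \<open>For bicyclic factors \<open>(i, j)\<close> and \<open>(k, l)\<close>,
  \<open>i + k - min j k \<ge> i\<close> and \<open>j + l - min j k \<ge> l\<close>, so large
  coordinates stay large.\<close>

lemma xmul_tail:
  assumes "x \<in> tail z n" "y \<in> tail w n"
  shows "xmul x y \<in> tail (z + w) n"
  using assms unfolding tail_def
  by (auto simp: e_add bicyclic_mult_def mul_commute)

text \<open>Left multiplication by \<open>(a, b)\<close> lowers the first coordinate by at most
  \<open>b\<close> and the second not at all, whence the threshold \<open>n + b\<close>. The next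
  lemma is the mirror image.\<close>

lemma xmul_Inl_tail:
  assumes "y \<in> tail z (n + b)"
  shows "xmul (Inl (a, b)) y \<in> tail (int a - int b + z) n"
  using assms unfolding tail_def
  by (auto simp: e_add[symmetric] bicyclic_mult_def)

lemma xmul_tail_Inl:
  assumes "x \<in> tail z (n + c)"
  shows "xmul x (Inl (c, d)) \<in> tail (z + (int c - int d)) n"
  using assms unfolding tail_def
  by (auto simp: e_add[symmetric] bicyclic_mult_def)

text \<open>Near a point of \<open>T\<close> membership in \<open>W\<close> is decided by
  \<open>val\<close> alone, so neighbourhoods of the factors can be pulled back from
  \<open>K\<close>, whatever the kind of the factors.\<close>

lemma xmul_nhds_T:
  assumes "xopen W" and x: "x \<in> carr" and y: "y \<in> carr"
    and W: "xmul x y \<in> W" and t: "xmul x y = Inr t" "t \<in> T"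
  shows "\<exists>U V. xopen U \<and> xopen V \<and> x \<in> U \<and> y \<in> V \<and> (\<forall>x\<in>U. \<forall>y\<in>V. xmul x y \<in> W)"
proof -
  obtain O' where O': "openin K O'" "t \<in> O'" "carr \<inter> val -` O' \<subseteq> W"
    using assms by (metis xopen_vimage_subset)
  have "val x \<cdot> val y = t" using val_xmul[of x y] t by simp
  then have "(val x, val y) \<in> {p \<in> topspace (prod_topology K K). (case p of (x, y) \<Rightarrow> x \<cdot> y) \<in> O'}"
    using O' val_in_K x y by simp
  moreover have "openin (prod_topology K K) {p \<in> topspace (prod_topology K K). (case p of (x, y) \<Rightarrow> x \<cdot> y) \<in> O'}"
    using continuous_mul O'(1) by (rule openin_continuous_map_preimage)
  ultimately obtain U V where UV: "openin K U" "openin K V" "val x \<in> U" "val y \<in> V"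
      and sub: "U \<times> V \<subseteq> {p \<in> topspace (prod_topology K K). (case p of (x, y) \<Rightarrow> x \<cdot> y) \<in> O'}"
    unfolding openin_prod_topology_alt by meson
  have "xmul x' y' \<in> W" if "x' \<in> carr \<inter> val -` U" "y' \<in> carr \<inter> val -` V" for x' y'
  proof -
    have "val x' \<cdot> val y' \<in> O'" using sub that by fastforce
    then show ?thesis using O'(3) that by (auto simp: val_xmul xmul_in_carr)
  qed
  then show ?thesis using UV x y xopen_vimage
    by (intro exI[of _ "carr \<inter> val -` U"] exI[of _ "carr \<inter> val -` V"]) auto
qed

text \<open>If the product is outside \<open>T\<close>, then so are both factors, by the ideal
  property. Only isolated points and tails remain.\<close>

lemma xmul_nhds:
  assumes W: "xopen W" "xmul x y \<in> W" and x: "x \<in> carr" and y: "y \<in> carr"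
  shows "\<exists>U V. xopen U \<and> xopen V \<and> x \<in> U \<and> y \<in> V \<and> (\<forall>x\<in>U. \<forall>y\<in>V. xmul x y \<in> W)"
proof (cases "\<exists>t\<in>T. xmul x y = Inr t")
  case True
  then show ?thesis using xmul_nhds_T W x y by blast
next
  case noT: False
  have e_tail: "Inr (e z) \<in> tail z n" for z n unfolding tail_def by simp
  from x show ?thesis
  proof (cases rule: carr_cases)
    case x: (bicyclic a b)
    from y show ?thesis
    proof (cases rule: carr_cases)
      case (bicyclic c d)
      then show ?thesis using x W xopen_Inl by blast
    next
      case (int z)
      then have "Inr (e (int a - int b + z)) \<in> W" using W x by (simp add: e_add)
      then obtain n where "tail (int a - int b + z) n \<subseteq> W" using W by (metis xopen_tail_subset)
      then show ?thesis using x int xopen_Inl[of "(a, b)"] xopen_tail[of z "n + b"] e_tail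
        xmul_Inl_tail[of _ z n b a]
        by (intro exI[of _ "{Inl (a, b)}"] exI[of _ "tail z (n + b)"]) auto
    next
      case (T t)
      then show ?thesis using noT x by (auto simp: e_mul_T)
    qed
  next
    case x: (int z)
    from y show ?thesis
    proof (cases rule: carr_cases)
      case (bicyclic c d)
      then have "Inr (e (z + (int c - int d))) \<in> W" using W x by (simp add: e_add)
      then obtain n where "tail (z + (int c - int d)) n \<subseteq> W" using W by (metis xopen_tail_subset)
      then show ?thesis using x bicyclic xopen_Inl[of "(c, d)"] xopen_tail[of z "n + c"] e_tail
        xmul_tail_Inl[of _ z n c d]
        by (intro exI[of _ "tail z (n + c)"] exI[of _ "{Inl (c, d)}"]) auto
    next
      case (int w)
      then have "Inr (e (z + w)) \<in> W" using W x by (simp add: e_add)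
      then obtain n where "tail (z + w) n \<subseteq> W" using W by (metis xopen_tail_subset)
      then show ?thesis using x int xopen_tail e_tail xmul_tail[of _ z n _ w]
        by (intro exI[of _ "tail z n"] exI[of _ "tail w n"]) auto
    next
      case (T t)
      then show ?thesis using noT x by (auto simp: e_mul_T)
    qed
  next
    case x: (T t)
    from y show ?thesis
      by (cases rule: carr_cases) (use noT x in \<open>auto simp: T_mul_T T_mul_e\<close>)
  qed
qed

lemma continuous_xmul: "continuous_map (prod_topology xtop xtop) xtop (\<lambda>(x, y). xmul x y)"
  unfolding continuous_map_def
proof (intro conjI allI impI)
  show "(\<lambda>(x, y). xmul x y) \<in> topspace (prod_topology xtop xtop) \<rightarrow> topspace xtop"
    using xmul_in_carr by (auto simp: topspace_xtop)
next
  fix W assume "openin xtop W"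
  then have W: "xopen W" by (simp add: openin_xtop)
  show "openin (prod_topology xtop xtop)
          {p \<in> topspace (prod_topology xtop xtop). (case p of (x, y) \<Rightarrow> xmul x y) \<in> W}"
    unfolding openin_prod_topology_alt openin_xtop
  proof (intro allI impI)
    fix x y
    assume "(x, y) \<in> {p \<in> topspace (prod_topology xtop xtop). (case p of (x, y) \<Rightarrow> xmul x y) \<in> W}"
    then have "x \<in> carr" "y \<in> carr" "xmul x y \<in> W" by (auto simp: topspace_xtop)
    from xmul_nhds[OF W this(3,1,2)] obtain U V
      where UV: "xopen U" "xopen V" "x \<in> U" "y \<in> V" "\<forall>x\<in>U. \<forall>y\<in>V. xmul x y \<in> W" by blast
    then have "U \<subseteq> carr" "V \<subseteq> carr" by (auto simp: xopen_def)
    with UV show "\<exists>U V. xopen U \<and> xopen V \<and> x \<in> U \<and> y \<in> V \<and>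
        U \<times> V \<subseteq> {p \<in> topspace (prod_topology xtop xtop). (case p of (x, y) \<Rightarrow> xmul x y) \<in> W}"
      by (intro exI[of _ U] exI[of _ V]) (auto simp: topspace_xtop)
  qed
qed

section \<open>Separation properties\<close>

lemma xopen_Compl_tail: "xopen (carr - tail z n)"
  unfolding xopen_def
proof (intro conjI allI impI ballI)
  show "\<exists>m. tail w m \<subseteq> carr - tail z n" if "Inr (e w) \<in> carr - tail z n" for w
  proof -
    have "w \<noteq> z" using that by (auto simp: tail_def)
    then have "tail w 0 \<subseteq> carr - tail z n" using injD[OF inj_e] by (auto simp: tail_def carr_def)
    then show ?thesis ..
  qed
  show "\<exists>U. openin K U \<and> t \<in> U \<and> carr \<inter> val -` U \<subseteq> carr - tail z n"
    if "t \<in> T" "Inr t \<in> carr - tail z n" for t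
  proof (intro exI conjI)
    \<comment> \<open>\<open>val\<close> equals \<open>e z\<close> throughout the tail, so it
      suffices to delete this point from \<open>K\<close>, which is T1.\<close>
    show "openin K (topspace K - {e z})"
      using Hausdorff_K by (simp add: Hausdorff_imp_t1_space closedin_t1_singleton e_in_K openin_diff)
    show "t \<in> topspace K - {e z}" using that T_subset e_notin_T by auto
  qed (auto simp: tail_def)
qed auto

lemma xopen_Compl_Inl: "xopen (carr - {Inl (i, j)})"
  unfolding xopen_def
proof (intro conjI allI impI ballI)
  show "\<exists>n. tail z n \<subseteq> carr - {Inl (i, j)}" for z
    \<comment> \<open>The bicyclic elements of \<open>tail z (Suc i)\<close> have first coordinate
      above \<open>i\<close>.\<close>
    by (rule exI[of _ "Suc i"]) (auto simp: tail_def carr_def)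
  show "\<exists>U. openin K U \<and> t \<in> U \<and> carr \<inter> val -` U \<subseteq> carr - {Inl (i, j)}"
    if "t \<in> T" "Inr t \<in> carr - {Inl (i, j)}" for t
  proof (intro exI conjI)
    show "openin K (topspace K - {e (int i - int j)})"
      using Hausdorff_K by (simp add: Hausdorff_imp_t1_space closedin_t1_singleton e_in_K openin_diff)
    show "t \<in> topspace K - {e (int i - int j)}" using that T_subset e_notin_T by auto
  qed auto
qed auto

text \<open>Singletons \<open>{Inl c}\<close> and tails are clopen. This serves both complete
  regularity and the Hausdorff property.\<close>

lemma clopen_nhd:
  assumes "xopen W" "x \<in> W" "\<forall>t\<in>T. x \<noteq> Inr t"
  shows "\<exists>V. xopen V \<and> xopen (carr - V) \<and> x \<in> V \<and> V \<subseteq> W"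
proof -
  have "x \<in> carr" using assms xopen_subset by blast
  then show ?thesis
  proof (cases rule: carr_cases)
    case (bicyclic i j)
    then show ?thesis using xopen_Inl xopen_Compl_Inl assms by blast
  next
    case (int z)
    then obtain n where "tail z n \<subseteq> W" using assms by (metis xopen_tail_subset)
    moreover have "x \<in> tail z n" using int by (simp add: tail_def)
    ultimately show ?thesis using xopen_tail xopen_Compl_tail by blast
  qed (use assms in auto)
qed

text \<open>At a point of \<open>T\<close> a separating function on \<open>K\<close> is composed
  with \<open>val\<close>; elsewhere the indicator of the complement of a clopen neighbourhood
  serves.\<close>

lemma completely_regular_xtop: "completely_regular_space xtop"
  unfolding completely_regular_space_alt'
proof (intro allI impI)
  fix W x assume "openin xtop W" and x: "x \<in> W"
  then have W: "xopen W" by (simp add: openin_xtop)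
  show "\<exists>f. continuous_map xtop euclideanreal f \<and> f x = 0 \<and> f ` (topspace xtop - W) \<subseteq> {1}"
  proof (cases "\<exists>t\<in>T. x = Inr t")
    case True
    then obtain t where t: "t \<in> T" "x = Inr t" by blast
    then obtain U where U: "openin K U" "t \<in> U" "carr \<inter> val -` U \<subseteq> W"
      using xopen_vimage_subset[OF W, of t] x by auto
    then obtain f where f: "continuous_map K euclideanreal f" "f t = 0" "f ` (topspace K - U) \<subseteq> {1}"
      using completely_regular_K unfolding completely_regular_space_alt' by meson
    have "continuous_map xtop euclideanreal (f \<circ> val)"
      using continuous_val f(1) by (rule continuous_map_compose)
    moreover have "(f \<circ> val) ` (topspace xtop - W) \<subseteq> {1}"
      using U f val_in_K by (fastforce simp: topspace_xtop)
    ultimately show ?thesis using f t by (intro exI[of _ "f \<circ> val"]) auto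
  next
    case False
    then obtain V where V: "xopen V" "xopen (carr - V)" "x \<in> V" "V \<subseteq> W"
      using clopen_nhd[OF W x] by auto
    then have "V \<subseteq> carr" by (simp add: xopen_def)
    define f :: "bicyclic + 'k \<Rightarrow> real" where "f y = (if y \<in> V then 0 else 1)" for y
    have "openin xtop {y \<in> topspace xtop. f y \<in> O'}" for O'
    proof -
      have "{y \<in> topspace xtop. f y \<in> O'} =
          (if 0 \<in> O' then V else {}) \<union> (if 1 \<in> O' then topspace xtop - V else {})"
        using \<open>V \<subseteq> carr\<close> by (auto simp: f_def topspace_xtop)
      moreover have "openin xtop V" "openin xtop (topspace xtop - V)"
        using V by (simp_all add: openin_xtop topspace_xtop)
      ultimately show ?thesis by auto
    qed
    then have "continuous_map xtop euclideanreal f" unfolding continuous_map_def by simp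
    moreover have "f x = 0" "f ` (topspace xtop - W) \<subseteq> {1}" using V by (auto simp: f_def)
    ultimately show ?thesis by blast
  qed
qed

lemma Hausdorff_xtop: "Hausdorff_space xtop"
  unfolding Hausdorff_space_def topspace_xtop openin_xtop
proof (intro allI impI)
  \<comment> \<open>For a point off \<open>T\<close>, an open set around it that misses the other
    point suffices, since it can be shrunk to a clopen one.\<close>
  have clopen: "\<exists>U V. xopen U \<and> xopen V \<and> x \<in> U \<and> y \<in> V \<and> disjnt U V"
    if xy: "x \<in> carr" "y \<in> carr" "x \<noteq> y" and x: "\<forall>t\<in>T. x \<noteq> Inr t" for x y
  proof -
    have "\<exists>W. xopen W \<and> x \<in> W \<and> y \<notin> W"
      using \<open>x \<in> carr\<close>
    proof (cases rule: carr_cases)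
      case (bicyclic i j)
      then show ?thesis using xy xopen_Inl by blast
    next
      case (int z)
      show ?thesis
      proof (cases y)
        case (Inl c)
        then show ?thesis using xy xopen_Compl_Inl[of "fst c" "snd c"] by auto
      next
        case (Inr k)
        then show ?thesis using int xy xopen_tail[of z 0] by (intro exI[of _ "tail z 0"]) (auto simp: tail_def)
      qed
    qed (use x in auto)
    then obtain W where "xopen W" "x \<in> W" "y \<notin> W" by blast
    then obtain V where "xopen V" "xopen (carr - V)" "x \<in> V" "V \<subseteq> W"
      using clopen_nhd[of W x] x by auto
    then show ?thesis using \<open>y \<notin> W\<close> \<open>y \<in> carr\<close>
      by (intro exI[of _ V] exI[of _ "carr - V"]) (auto simp: disjnt_def)
  qed
  fix x y assume xy: "x \<in> carr \<and> y \<in> carr \<and> x \<noteq> y"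
  consider "\<forall>t\<in>T. x \<noteq> Inr t" | "\<forall>t\<in>T. y \<noteq> Inr t" | s t where "s \<in> T" "t \<in> T" "x = Inr s" "y = Inr t"
    by blast
  then show "\<exists>U V. xopen U \<and> xopen V \<and> x \<in> U \<and> y \<in> V \<and> disjnt U V"
  proof cases
    case 1
    then show ?thesis using clopen xy by blast
  next
    case 2
    then show ?thesis using clopen[of y x] xy by (metis disjnt_sym)
  next
    case 3
    then obtain U V where UV: "openin K U" "openin K V" "s \<in> U" "t \<in> V" "disjnt U V"
      using Hausdorff_K xy T_subset unfolding Hausdorff_space_def by (metis subsetD)
    then show ?thesis using xopen_vimage[of U] xopen_vimage[of V] xy 3
      by (intro exI[of _ "carr \<inter> val -` U"] exI[of _ "carr \<inter> val -` V"]) (auto simp: disjnt_def)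
  qed
qed

section \<open>Density and accumulation of the bicyclic part\<close>

lemma xtop_closure_of_Inl: "xtop closure_of range Inl = topspace xtop"
proof -
  have "\<exists>c. Inl c \<in> W" if W: "xopen W" "x \<in> W" for x W
  proof -
    have "x \<in> carr" using W xopen_subset by blast
    then show ?thesis
    proof (cases rule: carr_cases)
      case (int z)
      then obtain n where n: "tail z n \<subseteq> W" using W by (metis xopen_tail_subset)
      \<comment> \<open>The difference of the coordinates is \<open>nat z - nat (- z) = z\<close>,
        computed in the integers.\<close>
      have "Inl (n + nat z, n + nat (- z)) \<in> tail z n" unfolding tail_def by auto
      then show ?thesis using n by blast
    next
      case (T t)
      then obtain U where U: "openin K U" "t \<in> U" "carr \<inter> val -` U \<subseteq> W"
        using xopen_vimage_subset[of W t] W T by auto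
      then obtain z where "e z \<in> U"
        using subsetD[OF T_subset_closure T(2)] unfolding in_closure_of by auto
      then have "Inl (nat z, nat (- z)) \<in> carr \<inter> val -` U" by (auto simp: carr_def)
      then show ?thesis using U by blast
    qed (use W in auto)
  qed
  then show ?thesis
    using closure_of_subset_topspace[of xtop] unfolding in_closure_of openin_xtop
    by (auto simp: closure_of_def openin_xtop)
qed

lemma xtop_accumulation:
  assumes "infinite (B :: bicyclic set)"
  shows "xtop derived_set_of (Inl ` B) \<noteq> {}"
proof (cases "finite ((\<lambda>(i, j). int i - int j) ` B)")
  case True
  then obtain c where "infinite {d \<in> B. (\<lambda>(i, j). int i - int j) d = (\<lambda>(i, j). int i - int j) c}"
    using pigeonhole_infinite[OF assms True] by blast
  then obtain z where inf: "infinite {d \<in> B. (\<lambda>(i, j). int i - int j) d = z}"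
    by blast
  have "Inr (e z) \<in> xtop derived_set_of (Inl ` B)"
    unfolding in_derived_set_of openin_xtop topspace_xtop
  proof (intro conjI allI impI)
    show "Inr (e z) \<in> carr" by (simp add: carr_def)
    fix W assume "Inr (e z) \<in> W \<and> xopen W"
    then obtain n where n: "tail z n \<subseteq> W" by (metis xopen_tail_subset)
    \<comment> \<open>The box is finite. If a pair has difference \<open>z\<close> and one
      coordinate above \<open>n + \<bar>z\<bar>\<close>, its other coordinate is above
      \<open>n\<close>, so the pair lies in the tail.\<close>
    have "\<not> {d \<in> B. (\<lambda>(i, j). int i - int j) d = z} \<subseteq> {..n + nat \<bar>z\<bar>} \<times> {..n + nat \<bar>z\<bar>}"
      using inf finite_subset by blast
    then obtain i j where "(i, j) \<in> B" "int i - int j = z" "\<not> (i \<le> n + nat \<bar>z\<bar> \<and> j \<le> n + nat \<bar>z\<bar>)"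
      by fastforce
    moreover from this have "Inl (i, j) \<in> tail z n" unfolding tail_def by auto
    ultimately show "\<exists>y. y \<noteq> Inr (e z) \<and> y \<in> Inl ` B \<and> y \<in> W" using n by blast
  qed
  then show ?thesis by blast
next
  case False
  then obtain t where t: "t \<in> T" "t \<in> K derived_set_of (e ` (\<lambda>(i, j). int i - int j) ` B)"
    using accumulation_in_T by blast
  have "Inr t \<in> xtop derived_set_of (Inl ` B)"
    unfolding in_derived_set_of openin_xtop topspace_xtop
  proof (intro conjI allI impI)
    show "Inr t \<in> carr" using t by (simp add: carr_def)
    fix W assume "Inr t \<in> W \<and> xopen W"
    then obtain U where U: "openin K U" "t \<in> U" "carr \<inter> val -` U \<subseteq> W"
      using xopen_vimage_subset[of W t] t by auto
    then obtain y where "y \<in> e ` (\<lambda>(i, j). int i - int j) ` B" "y \<in> U"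
      using t(2) U(1,2) by (metis in_derived_set_of)
    then obtain i j where ij: "(i, j) \<in> B" "e (int i - int j) \<in> U"
      by auto
    then have "Inl (i, j) \<in> W" using U(3) by (auto simp: carr_def)
    then show "\<exists>y. y \<noteq> Inr t \<and> y \<in> Inl ` B \<and> y \<in> W" using ij by blast
  qed
  then show ?thesis by blast
qed

theorem xtop_properties:
  "topological_semigroup xtop xmul" "Tychonoff_space xtop" "countably_pracompact xtop"
  "range Inl \<subseteq> topspace xtop"
proof -
  show "topological_semigroup xtop xmul"
    unfolding topological_semigroup_def topspace_xtop
    using Hausdorff_xtop xmul_in_carr xmul_assoc continuous_xmul by blast
  show "Tychonoff_space xtop"
    unfolding Tychonoff_space_def using Hausdorff_xtop completely_regular_xtop by blast
  show "range Inl \<subseteq> topspace xtop" by (auto simp: topspace_xtop carr_def)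
  then show "countably_pracompact xtop"
    unfolding countably_pracompact_def
    using xtop_closure_of_Inl xtop_accumulation
    by (intro exI[of _ "range Inl"]) (metis finite_imageI subset_imageE)
qed

end

section \<open>Accumulation points of the integers\<close>

definition chi :: "int \<Rightarrow> real \<Rightarrow> complex" where
  "chi z \<theta> = cis (of_int z * \<theta>)"

lemma chi_add: "chi (z + w) \<theta> = chi z \<theta> * chi w \<theta>"
  by (simp add: chi_def cis_mult ring_distribs)

lemma chi_nonzero [simp]: "chi z \<theta> \<noteq> 0"
  by (simp add: chi_def)

lemma inj_chi: "inj chi"
proof (rule injI, rule ccontr)
  fix z w assume eq: "chi z = chi w" and "z \<noteq> w"
  \<comment> \<open>At this angle the character of \<open>z - w\<close> takes the value -1.\<close>
  define \<theta> where "\<theta> = pi / of_int (z - w)"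
  have "chi (z - w) \<theta> * chi w \<theta> = 1 * chi w \<theta>"
    using eq by (simp flip: chi_add)
  then have "chi (z - w) \<theta> = 1" by (simp del: mult_1)
  moreover have "chi (z - w) \<theta> = -1"
    using \<open>z \<noteq> w\<close> by (simp add: chi_def \<theta>_def)
  ultimately show False by simp
qed

lemma cos_ge_half:
  fixes x :: real
  assumes "\<bar>x\<bar> \<le> pi / 3"
  shows "1 / 2 \<le> cos x"
proof -
  have "cos (pi / 3) \<le> cos \<bar>x\<bar>"
    using assms by (intro cos_monotone_0_pi_le) auto
  then show ?thesis by (simp add: cos_60)
qed

text \<open>Around suitable centres, closed intervals on which the n-th phase stays within a sixth
  of a turn of its target are nested by lacunarity. A common point, times \<open>2 * pi\<close>, is
  the angle.\<close>

lemma lacunary_phase: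
  fixes a :: "nat \<Rightarrow> int" and E :: "nat set"
  assumes a0: "a 0 \<noteq> 0" and lacunary: "\<And>n. 4 * \<bar>a n\<bar> \<le> \<bar>a (Suc n)\<bar>"
  obtains \<theta> where "\<And>n. n \<in> E \<Longrightarrow> 1 / 2 \<le> Re (chi (a n) \<theta>)"
    and "\<And>n. n \<notin> E \<Longrightarrow> Re (chi (a n) \<theta>) \<le> - 1 / 2"
proof -
  define A :: "nat \<Rightarrow> real" where "A n = of_int (a n)" for n
  \<comment> \<open>Target phases measured in turns: the cosine is 1 at phase 0 and -1 at phase
    1/2.\<close>
  define c :: "nat \<Rightarrow> real" where "c n = (if n \<in> E then 0 else 1 / 2)" for n
  have a_nz: "a n \<noteq> 0" for n
  proof (induction n)
    case (Suc n)
    then show ?case using lacunary[of n] by auto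
  qed (rule a0)
  then have A_nz: "A n \<noteq> 0" for n by (simp add: A_def)
  have A_lac: "4 * \<bar>A n\<bar> \<le> \<bar>A (Suc n)\<bar>" for n
    using lacunary[of n] unfolding A_def by linarith
  \<comment> \<open>p (n + 1) is the point nearest to p n at which A (n + 1) has exactly the phase c (n + 1) mod 1.\<close>
  define p where "p = rec_nat (c 0 / A 0)
    (\<lambda>n x. (of_int (round (A (Suc n) * x - c (Suc n))) + c (Suc n)) / A (Suc n))"
  have p0: "p 0 = c 0 / A 0" by (simp add: p_def)
  have pS: "p (Suc n) = (of_int (round (A (Suc n) * p n - c (Suc n))) + c (Suc n)) / A (Suc n)" for n
    by (simp add: p_def)
  have phase: "\<exists>k::int. A n * p n = of_int k + c n" for n
    using A_nz by (cases n) (auto simp: p0 pS intro: exI[of _ 0])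
  \<comment> \<open>On \<open>I n\<close> the phase deviates by at most 1/6 turn, an angle of
    \<open>pi / 3\<close>, from that at the centre.\<close>
  define I where "I n = cball (p n) (1 / (6 * \<bar>A n\<bar>))" for n
  have "I (Suc n) \<subseteq> I n" for n
  proof -
    have "A (Suc n) * (p (Suc n) - p n) =
        of_int (round (A (Suc n) * p n - c (Suc n))) - (A (Suc n) * p n - c (Suc n))"
      using A_nz[of "Suc n"] by (simp add: pS right_diff_distrib)
    also have "\<bar>\<dots>\<bar> \<le> 1 / 2"
      by (rule of_int_round_abs_le)
    finally have "\<bar>A (Suc n)\<bar> * \<bar>p (Suc n) - p n\<bar> \<le> 1 / 2" by (simp add: abs_mult)
    then have "\<bar>p (Suc n) - p n\<bar> \<le> 1 / (2 * \<bar>A (Suc n)\<bar>)"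
      using A_nz[of "Suc n"] by (simp add: field_simps)
    \<comment> \<open>Displacement plus new radius is 1/2 + 1/6 = 4/6 in units of
      \<open>1 / \<bar>A (Suc n)\<bar>\<close>; the lacunarity factor 4 absorbs the
      numerator.\<close>
    then have "dist (p (Suc n)) (p n) + 1 / (6 * \<bar>A (Suc n)\<bar>) \<le> 4 / (6 * \<bar>A (Suc n)\<bar>)"
      using A_nz[of "Suc n"] by (simp add: dist_real_def field_simps)
    also have "\<dots> \<le> 1 / (6 * \<bar>A n\<bar>)"
      using A_nz[of n] A_nz[of "Suc n"] A_lac[of n] by (simp add: field_simps)
    finally show ?thesis unfolding I_def cball_subset_cball_iff by simp
  qed
  then have "I n \<subseteq> I m" if "m \<le> n" for m n
    using that lift_Suc_antimono_le[of I] by blast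
  then have "\<Inter> (range I) \<noteq> {}"
    by (intro compact_nest) (auto simp: I_def)
  then obtain x where x: "\<And>n. x \<in> I n" by blast
  have key: "\<exists>\<delta>. \<bar>\<delta>\<bar> \<le> pi / 3 \<and> Re (chi (a n) (2 * pi * x)) = cos (2 * pi * c n + \<delta>)" for n
  proof -
    obtain k where k: "A n * p n = of_int k + c n" using phase by blast
    have "\<bar>x - p n\<bar> \<le> 1 / (6 * \<bar>A n\<bar>)"
      using x[of n] by (simp add: I_def dist_real_def abs_minus_commute)
    then have "\<bar>A n\<bar> * \<bar>x - p n\<bar> \<le> \<bar>A n\<bar> * (1 / (6 * \<bar>A n\<bar>))"
      by (rule mult_left_mono) simp
    then have "\<bar>A n * (x - p n)\<bar> \<le> 1 / 6"
      using A_nz[of n] by (simp add: abs_mult)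
    then have "\<bar>2 * pi * (A n * (x - p n))\<bar> \<le> 2 * pi * (1 / 6)"
      unfolding abs_mult[of "2 * pi"] by (intro mult_mono) auto
    moreover have "A n * (2 * pi * x) = (2 * pi * c n + 2 * pi * (A n * (x - p n))) + 2 * pi * of_int k"
      using k by (simp add: algebra_simps)
    then have "Re (chi (a n) (2 * pi * x)) = cos (2 * pi * c n + 2 * pi * (A n * (x - p n)))"
      unfolding chi_def cis.sel A_def[symmetric]
      by (simp add: cos_add cos_int_2pin sin_int_2pin)
    ultimately show ?thesis by (intro exI[of _ "2 * pi * (A n * (x - p n))"]) auto
  qed
  show thesis
  proof
    fix n assume "n \<in> E"
    then show "1 / 2 \<le> Re (chi (a n) (2 * pi * x))"
      using key[of n] cos_ge_half by (auto simp: c_def)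
  next
    fix n assume "n \<notin> E"
    then show "Re (chi (a n) (2 * pi * x)) \<le> - 1 / 2"
      using key[of n] cos_ge_half by (fastforce simp: c_def)
  qed
qed

text \<open>The Fichtenholz-Kantorovich construction. For all large \<open>k\<close> the members of
  \<open>F\<close> have distinct traces on \<open>{..<k}\<close>, so coding the traces of those
  \<open>x\<close> with \<open>\<delta> x\<close> yields one suitable number for each such
  \<open>k\<close>.\<close>

lemma independent_family:
  obtains E :: "nat set \<Rightarrow> nat set"
  where "\<And>\<delta> F. finite F \<Longrightarrow> infinite {n. \<forall>x\<in>F. n \<in> E x \<longleftrightarrow> \<delta> x}"
proof
  \<comment> \<open>A number codes k and a list of subsets of {..<k}; it lies in E x iff the trace of x on {..<k}
    is one of them.\<close>
  define tr where "tr k x = map (\<lambda>i. i \<in> x) [0..<k]" for k and x :: "nat set"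
  define E where "E x = {n. case from_nat n of (k, G) \<Rightarrow> tr k x \<in> set (G :: bool list list)}" for x
  fix \<delta> :: "nat set \<Rightarrow> bool" and F :: "nat set set"
  assume F: "finite F"
  have "\<exists>i. x \<noteq> y \<longrightarrow> (i \<in> x) \<noteq> (i \<in> y)" for x y :: "nat set" by blast
  then obtain d where d: "\<And>x y :: nat set. x \<noteq> y \<Longrightarrow> (d x y \<in> x) \<noteq> (d x y \<in> y)" by metis
  obtain k0 where k0: "\<And>x y. x \<in> F \<Longrightarrow> y \<in> F \<Longrightarrow> d x y < k0"
  proof -
    have "finite (case_prod d ` (F \<times> F))" using F by simp
    then obtain k where "\<forall>i\<in>case_prod d ` (F \<times> F). i < k"
      using finite_nat_set_iff_bounded by blast
    then show thesis by (intro that[of k]) auto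
  qed
  have tr_inj: "x = y" if xy: "x \<in> F" "y \<in> F" and k: "k0 \<le> k" and eq: "tr k x = tr k y" for x y k
  proof (rule ccontr)
    assume "x \<noteq> y"
    have "\<forall>i<k. (i \<in> x) = (i \<in> y)" using eq by (auto simp: tr_def)
    moreover have "d x y < k" using k0 xy k by force
    ultimately show False using d[OF \<open>x \<noteq> y\<close>] by blast
  qed
  have "\<exists>G. set G = tr k ` {x\<in>F. \<delta> x}" for k using F by (intro finite_list) auto
  then obtain G where G: "\<And>k. set (G k) = tr k ` {x\<in>F. \<delta> x}" by metis
  define N where "N k = to_nat (k, G k)" for k
  have "inj N" by (rule injI) (simp add: N_def)
  have "N k \<in> {n. \<forall>x\<in>F. n \<in> E x \<longleftrightarrow> \<delta> x}" if "k0 \<le> k" for k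
    using tr_inj that by (auto simp: N_def E_def G)
  then have "N ` {k0..} \<subseteq> {n. \<forall>x\<in>F. n \<in> E x \<longleftrightarrow> \<delta> x}" by auto
  moreover have "infinite (N ` {k0..})"
    using \<open>inj N\<close> by (simp add: finite_image_iff inj_on_subset[of N UNIV] infinite_Ici)
  ultimately show "infinite {n. \<forall>x\<in>F. n \<in> E x \<longleftrightarrow> \<delta> x}" using finite_subset by blast
qed

lemma lacunary_sequence:
  fixes B :: "int set"
  assumes "infinite B"
  obtains a where "\<And>n :: nat. a n \<in> B" "a 0 \<noteq> 0" "\<And>n. 4 * \<bar>a n\<bar> \<le> \<bar>a (Suc n)\<bar>"
proof -
  have big: "\<exists>b\<in>B. N \<le> \<bar>b\<bar>" for N
  proof (rule ccontr)
    assume "\<not> ?thesis"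
    then have "B \<subseteq> {-N..N}" by force
    then show False using assms finite_subset by blast
  qed
  \<comment> \<open>The first term alone is required to be nonzero; growth gives it for the
    others.\<close>
  have "\<exists>a. \<forall>n::nat. (a n \<in> B \<and> (n = 0 \<longrightarrow> a n \<noteq> 0)) \<and> 4 * \<bar>a n\<bar> \<le> \<bar>a (Suc n)\<bar>"
  proof (rule dependent_nat_choice)
    show "\<exists>x. x \<in> B \<and> (0 = 0 \<longrightarrow> x \<noteq> 0)" using big[of 1] by force
  qed (use big in auto)
  then show thesis using that by blast
qed

section \<open>Accumulation points avoiding continuum many values\<close>

lemma continuous_on_eval: "continuous_on S (\<lambda>f. f x)"
  by (rule continuous_on_product_coordinates[THEN continuous_on_subset]) simp

text \<open>The angles depend on \<open>B\<close> alone and precede \<open>F\<close>, so that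
  \<open>F\<close> can encode all conditions of one stage of the recursion. Independence and
  compactness give a cluster point whose real part has a prescribed sign at every angle at
  once.\<close>

lemma accumulation_avoiding:
  fixes B :: "int set"
  assumes "infinite B"
  shows "\<exists>\<theta> :: nat set \<Rightarrow> real. \<forall>F. \<exists>t \<in> euclidean derived_set_of (chi ` B). \<forall>x. t (\<theta> x) \<noteq> F x"
proof -
  obtain a where aB: "\<And>n::nat. a n \<in> B" and a0: "a 0 \<noteq> 0"
    and lac: "\<And>n. 4 * \<bar>a n\<bar> \<le> \<bar>a (Suc n)\<bar>"
    using lacunary_sequence[OF assms] by blast
  have a_nz: "a n \<noteq> 0" for n
  proof (induction n)
    case (Suc n)
    then show ?case using lac[of n] by auto
  qed (rule a0)
  have "strict_mono (\<lambda>n. \<bar>a n\<bar>)"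
    unfolding strict_mono_Suc_iff
  proof
    fix n show "\<bar>a n\<bar> < \<bar>a (Suc n)\<bar>" using lac[of n] a_nz[of n] by linarith
  qed
  then have a_inj: "a m \<noteq> a n" if "m \<noteq> n" for m n
    using that strict_mono_eq by metis
  obtain E :: "nat set \<Rightarrow> nat set"
    where E: "\<And>\<delta> F. finite F \<Longrightarrow> infinite {n. \<forall>x\<in>F. n \<in> E x \<longleftrightarrow> \<delta> x}"
    using independent_family by blast
  have "\<exists>\<theta>. (\<forall>n\<in>E x. 1 / 2 \<le> Re (chi (a n) \<theta>)) \<and> (\<forall>n. n \<notin> E x \<longrightarrow> Re (chi (a n) \<theta>) \<le> - 1 / 2)" for x
    using lacunary_phase[OF a0 lac, of "E x"] by metis
  then obtain \<theta> where \<theta>: "\<And>x n. n \<in> E x \<Longrightarrow> 1 / 2 \<le> Re (chi (a n) (\<theta> x))"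
      "\<And>x n. n \<notin> E x \<Longrightarrow> Re (chi (a n) (\<theta> x)) \<le> - 1 / 2"
    by metis
  show ?thesis
  proof (intro exI[of _ \<theta>] allI)
    fix F :: "nat set \<Rightarrow> complex"
    \<comment> \<open>Force Re (t (\<theta> x)) to have the sign that Re (F x) does not have.\<close>
    define \<delta> where "\<delta> x \<longleftrightarrow> Re (F x) \<le> 0" for x
    \<comment> \<open>Indices at which the characters have the desired signs at the angles of
      \<open>P\<close>. The bound \<open>N\<close> makes the cluster point of these sets an
      accumulation point.\<close>
    define S where "S = (\<lambda>(N, P). {n::nat. N \<le> n \<and> (\<forall>x\<in>P. n \<in> E x \<longleftrightarrow> \<delta> x)})"
    have S_ne: "S (N, P) \<noteq> {}" if "finite P" for N P
    proof -
      have "\<exists>n\<ge>N. n \<in> {n. \<forall>x\<in>P. n \<in> E x \<longleftrightarrow> \<delta> x}"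
        using E[OF that] unfolding infinite_nat_iff_unbounded_le by blast
      then show ?thesis by (auto simp: S_def)
    qed
    \<comment> \<open>The torus containing all characters, compact by Tychonoff's theorem.\<close>
    define C :: "(real \<Rightarrow> complex) set" where "C = PiE UNIV (\<lambda>_. sphere 0 1)"
    have "compact C"
    proof -
      have "compactin (product_topology (\<lambda>_::real. euclidean :: complex topology) UNIV) C"
        unfolding C_def compactin_PiE by simp
      then show ?thesis by (simp add: euclidean_product_topology)
    qed
    let ?I = "{(N::nat, P::nat set set). finite P}"
    let ?f = "\<lambda>i. closure ((\<lambda>n. chi (a n)) ` S i)"
    have "C \<inter> (\<Inter>i\<in>?I. ?f i) \<noteq> {}"
    proof (rule compact_imp_fip_image[OF \<open>compact C\<close>])
      fix J assume J: "finite J" "J \<subseteq> ?I"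
      \<comment> \<open>The sum serves only as a common upper bound of the first components.\<close>
      define N where "N = (\<Sum>i\<in>J. fst i)"
      define P where "P = (\<Union>i\<in>J. snd i)"
      have "finite P" using J by (auto simp: P_def)
      then obtain n where n: "n \<in> S (N, P)" using S_ne by blast
      have nS: "n \<in> S i" if "i \<in> J" for i
      proof -
        have "fst i \<le> N" unfolding N_def using that J(1) by (intro member_le_sum) auto
        moreover have "snd i \<subseteq> P" unfolding P_def using that by blast
        ultimately show ?thesis using n by (cases i) (auto simp: S_def)
      qed
      have "chi (a n) \<in> ?f i" if "i \<in> J" for i
        using nS[OF that] closure_subset[of "(\<lambda>n. chi (a n)) ` S i"] by blast
      moreover have "chi (a n) \<in> C" by (auto simp: C_def chi_def)
      ultimately show "C \<inter> (\<Inter>i\<in>J. ?f i) \<noteq> {}" by blast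
    qed simp
    then obtain t where "t \<in> C \<inter> (\<Inter>i\<in>?I. ?f i)" by (meson ex_in_conv)
    then have t: "t \<in> ?f (N, P)" if "finite P" for N P
      using that \<open>t \<in> _\<close> by simp
    have "t (\<theta> x) \<noteq> F x" for x
    proof (cases "\<delta> x")
      case True
      \<comment> \<open>The sign bound holds for the characters indexed by \<open>S (0, {x})\<close>
        and passes to the closure, where \<open>t\<close> lies.\<close>
      have "closed {f :: real \<Rightarrow> complex. 1 / 2 \<le> Re (f (\<theta> x))}"
        by (intro closed_Collect_le continuous_intros continuous_on_eval)
      moreover have "(\<lambda>n. chi (a n)) ` S (0, {x}) \<subseteq> {f. 1 / 2 \<le> Re (f (\<theta> x))}"
        using \<theta>(1) True by (auto simp: S_def)
      ultimately have "1 / 2 \<le> Re (t (\<theta> x))"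
        using t[of "{x}" 0] closure_minimal by blast
      then show ?thesis using True by (auto simp: \<delta>_def)
    next
      case False
      have "closed {f :: real \<Rightarrow> complex. Re (f (\<theta> x)) \<le> - 1 / 2}"
        by (intro closed_Collect_le continuous_intros continuous_on_eval)
      moreover have "(\<lambda>n. chi (a n)) ` S (0, {x}) \<subseteq> {f. Re (f (\<theta> x)) \<le> - 1 / 2}"
        using \<theta>(2) False by (auto simp: S_def)
      ultimately have "Re (t (\<theta> x)) \<le> - 1 / 2"
        using t[of "{x}" 0] closure_minimal by blast
      then show ?thesis using False by (auto simp: \<delta>_def)
    qed
    moreover have "t \<in> euclidean derived_set_of (chi ` B)"
      unfolding in_derived_set_of
    proof (intro conjI allI impI)
      fix W assume W: "t \<in> W \<and> openin euclidean W"
      have ex: "\<exists>n\<ge>N. chi (a n) \<in> W" for N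
      proof -
        have "W \<inter> (\<lambda>n. chi (a n)) ` S (N, {}) \<noteq> {}"
          using W t[of "{}" N] open_Int_closure_eq_empty[of W] by auto
        then show ?thesis by (auto simp: S_def)
      qed
      \<comment> \<open>Two distinct characters in \<open>W\<close>, at least one of which differs
        from \<open>t\<close>.\<close>
      obtain m n where "chi (a m) \<in> W" "chi (a n) \<in> W" "Suc m \<le> n"
        using ex by metis
      moreover from this have "chi (a m) \<noteq> chi (a n)"
        using injD[OF inj_chi] a_inj[of m n] by auto
      ultimately show "\<exists>y. y \<noteq> t \<and> y \<in> chi ` B \<and> y \<in> W" using aB by (metis imageI)
    qed simp
    ultimately show "\<exists>t \<in> euclidean derived_set_of (chi ` B). \<forall>x. t (\<theta> x) \<noteq> F x" by blast
  qed
qed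

section \<open>Equations to avoid and the transfinite recursion\<close>

lemma closure_chi_power:
  assumes "t \<in> closure (range chi)"
  shows "t (of_nat m * \<theta>) = t \<theta> ^ m"
proof -
  \<comment> \<open>The characters satisfy this closed condition by de Moivre's formula.\<close>
  have "closed {t :: real \<Rightarrow> complex. t (of_nat m * \<theta>) = t \<theta> ^ m}"
    by (intro closed_Collect_eq continuous_intros continuous_on_eval)
  moreover have "chi z (of_nat m * \<theta>) = chi z \<theta> ^ m" for z
    unfolding chi_def Complex.DeMoivre by (simp only: mult.left_commute)
  then have "range chi \<subseteq> {t. t (of_nat m * \<theta>) = t \<theta> ^ m}" by blast
  ultimately show ?thesis using assms closure_minimal by blast
qed

text \<open>A triple \<open>(m, z, l)\<close> stands for the equation "the m-th power of the new
  point times the points of the sets in \<open>l\<close> is \<open>chi z\<close>". Coding it as a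
  set of naturals gives each equation its own angle.\<close>

lemma inj_constraint_code:
  obtains code :: "nat \<times> int \<times> int set list \<Rightarrow> nat set" where "inj code"
proof
  \<comment> \<open>The \<open>None\<close> entry preserves \<open>m\<close>, \<open>z\<close> and
    the length even if all sets in \<open>l\<close> are empty; the indices \<open>i\<close> preserve
    order and repetitions.\<close>
  define D where "D = (\<lambda>(m :: nat, z :: int, l :: int set list). insert (m, z, length l, None)
    {(m, z, length l, Some (i, b)) |i b. i < length l \<and> b \<in> l ! i})"
  have "inj D"
  proof (rule injI)
    fix x y assume eq: "D x = D y"
    obtain m z l where x: "x = (m, z, l)" by (cases x)
    obtain m' z' l' where y: "y = (m', z', l')" by (cases y)
    have mz: "m = m' \<and> z = z' \<and> length l = length l'"
      using equalityD1[OF eq] by (auto simp: x y D_def)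
    have "l ! i = l' ! i" if "i < length l" for i
    proof (rule set_eqI)
      fix b
      have "(m, z, length l, Some (i, b)) \<in> D x \<longleftrightarrow> (m, z, length l, Some (i, b)) \<in> D y"
        unfolding eq ..
      then show "b \<in> l ! i \<longleftrightarrow> b \<in> l' ! i" using mz that by (simp add: x y D_def)
    qed
    then have "l = l'" using mz by (intro nth_equalityI) auto
    then show "x = y" using x y mz by simp
  qed
  then show "inj (\<lambda>x. to_nat ` D x)"
    by (simp add: inj_def inj_image_eq_iff)
qed

text \<open>Collects the occurrences of one factor, later that of the largest set in the list, into
  a power.\<close>

lemma prod_list_filter_eq:
  "prod_list (map g l) = g x ^ count_list l x * prod_list (map g (filter (\<lambda>y. y \<noteq> x) l))"
  for g :: "'a \<Rightarrow> 'b :: comm_monoid_mult"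
  by (induction l) (auto simp: mult_ac)

text \<open>A forbidden relation, read as a condition on the point of the largest set involved, is
  among the equations avoided at the stage of that set.\<close>

lemma independent_accumulation_points:
  "\<exists>f. (\<forall>B. infinite B \<longrightarrow> f B \<in> euclidean derived_set_of (chi ` B)) \<and>
     (\<forall>l z. l \<noteq> [] \<longrightarrow> (\<forall>B\<in>set l. infinite B) \<longrightarrow> (\<lambda>\<theta>. prod_list (map (\<lambda>B. f B \<theta>) l)) \<noteq> chi z)"
proof -
  obtain r :: "int set rel" where r: "Well_order r" "Field r = UNIV"
    using well_ordering by metis
  define R where "R = r - Id"
  have wf: "wf R" and total: "total r"
    using r by (auto simp: R_def well_order_on_def linear_order_on_def)
  \<comment> \<open>The requirement at stage \<open>A\<close>, given the points of smaller sets; the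
    exponent \<open>m\<close> accounts for repeated occurrences of \<open>A\<close>.\<close>
  define P :: "(int set \<Rightarrow> real \<Rightarrow> complex) \<Rightarrow> int set \<Rightarrow> (real \<Rightarrow> complex) \<Rightarrow> bool" where
    "P f A t \<longleftrightarrow> infinite A \<longrightarrow> t \<in> euclidean derived_set_of (chi ` A) \<and>
      (\<forall>m z l. 0 < m \<longrightarrow> (\<forall>B\<in>set l. (B, A) \<in> R) \<longrightarrow>
        (\<exists>\<theta>. t \<theta> ^ m * prod_list (map (\<lambda>B. f B \<theta>) l) \<noteq> chi z \<theta>))" for f A t
  have "\<exists>f. \<forall>A. P f A (f A)"
  proof (rule dependent_wf_choice[OF wf])
    fix f g :: "int set \<Rightarrow> real \<Rightarrow> complex" and A t
    assume "\<And>B. (B, A) \<in> R \<Longrightarrow> f B = g B"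
    then have "map (\<lambda>B. f B \<theta>) l = map (\<lambda>B. g B \<theta>) l" if "\<forall>B\<in>set l. (B, A) \<in> R" for l \<theta>
      using that by auto
    then show "P f A t = P g A t" unfolding P_def by metis
  next
    fix A and f :: "int set \<Rightarrow> real \<Rightarrow> complex"
    show "\<exists>t. P f A t"
    proof (cases "finite A")
      case False
      obtain \<theta> :: "nat set \<Rightarrow> real"
        where \<theta>: "\<forall>F. \<exists>t \<in> euclidean derived_set_of (chi ` A). \<forall>x. t (\<theta> x) \<noteq> F x"
        using accumulation_avoiding[OF False] ..
      obtain code :: "nat \<times> int \<times> int set list \<Rightarrow> nat set" where code: "inj code"
        by (rule inj_constraint_code)
      \<comment> \<open>Dividing the angle by m turns a condition on t ^ m into one on t, since t is multiplicative.\<close>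
      define s where "s x = \<theta> (code x) / of_nat (fst x)" for x
      \<comment> \<open>The value of the m-th power that would satisfy the equation at this angle.
        If the product vanishes, the quotient is 0 by convention, but then the equation fails anyway
        because \<open>chi\<close> has no zeros.\<close>
      define G where "G = (\<lambda>(m, z, l). chi z (s (m, z, l)) / prod_list (map (\<lambda>B. f B (s (m, z, l))) l))"
      obtain t where t: "t \<in> euclidean derived_set_of (chi ` A)" "\<And>x. t (\<theta> x) \<noteq> (G \<circ> inv code) x"
        using \<theta>[THEN spec, of "G \<circ> inv code"] by (elim bexE) (rule that, assumption, erule spec)
      have "t \<in> closure (range chi)"
        using t(1) derived_set_of_mono[of "chi ` A" "range chi" euclidean]
          derived_set_of_subset_closure_of[of euclidean "range chi"] by auto
      note power = closure_chi_power[OF this]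
      have "t (s (m, z, l)) ^ m * prod_list (map (\<lambda>B. f B (s (m, z, l))) l) \<noteq> chi z (s (m, z, l))"
        if "0 < m" for m z l
      proof
        assume eq: "t (s (m, z, l)) ^ m * prod_list (map (\<lambda>B. f B (s (m, z, l))) l) = chi z (s (m, z, l))"
        then have "prod_list (map (\<lambda>B. f B (s (m, z, l))) l) \<noteq> 0"
          using chi_nonzero by (metis mult_zero_right)
        then have "t (s (m, z, l)) ^ m = G (m, z, l)"
          using eq by (simp add: G_def field_simps)
        moreover have "of_nat m * s (m, z, l) = \<theta> (code (m, z, l))"
          using that by (simp add: s_def)
        ultimately show False
          using power[of m "s (m, z, l)"] t(2)[of "code (m, z, l)"] code by simp
      qed
      then show ?thesis unfolding P_def using t(1) by (intro exI[of _ t]) blast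
    qed (auto simp: P_def)
  qed
  then obtain f where f: "\<And>A. P f A (f A)" by blast
  show ?thesis
  proof (intro exI[of _ f] conjI allI impI)
    show "f B \<in> euclidean derived_set_of (chi ` B)" if "infinite B" for B
      using f[of B] that by (auto simp: P_def)
  next
    fix l :: "int set list" and z
    assume "l \<noteq> []" and inf: "\<forall>B\<in>set l. infinite B"
    \<comment> \<open>The largest entry of the list in the well-ordering; its multiplicity becomes
      \<open>m\<close>.\<close>
    have "\<exists>A\<in>set l. \<forall>B\<in>set l. B \<noteq> A \<longrightarrow> (B, A) \<in> R"
      using \<open>l \<noteq> []\<close>
    proof (induction l rule: list_nonempty_induct)
      case (cons B l)
      then obtain A where A: "A \<in> set l" "\<forall>B\<in>set l. B \<noteq> A \<longrightarrow> (B, A) \<in> R" by blast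
      have "trans r" using r by (simp add: well_order_on_def linear_order_on_def partial_order_on_def preorder_on_def)
      consider "B = A" | "B \<noteq> A" "(B, A) \<in> r" | "B \<noteq> A" "(A, B) \<in> r"
        using total by (auto simp: total_on_def)
      then show ?case
      proof cases
        case 3
        then have "\<forall>D\<in>set l. (D, B) \<in> r" using A \<open>trans r\<close> by (auto simp: R_def dest: transD)
        then show ?thesis by (auto simp: R_def)
      qed (use A in \<open>auto simp: R_def\<close>)
    qed auto
    then obtain A where A: "A \<in> set l" "\<forall>B\<in>set l. B \<noteq> A \<longrightarrow> (B, A) \<in> R" by blast
    have "0 < count_list l A" using A(1) by (simp add: count_list_0_iff zero_less_iff_neq_zero)
    moreover have "\<forall>B\<in>set (filter (\<lambda>B. B \<noteq> A) l). (B, A) \<in> R" using A by auto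
    ultimately obtain \<theta> where "f A \<theta> ^ count_list l A *
        prod_list (map (\<lambda>B. f B \<theta>) (filter (\<lambda>B. B \<noteq> A) l)) \<noteq> chi z \<theta>"
      using f[of A] A inf unfolding P_def by meson
    then have "prod_list (map (\<lambda>B. f B \<theta>) l) \<noteq> chi z \<theta>"
      by (simp add: prod_list_filter_eq[of _ l A])
    then show "(\<lambda>\<theta>. prod_list (map (\<lambda>B. f B \<theta>) l)) \<noteq> chi z" by metis
  qed
qed

section \<open>Transport along an injection\<close>

lemma homeomorphic_map_the_inv:
  fixes X :: "'a topology" and g :: "'a \<Rightarrow> 'b"
  assumes "inj g"
  shows "homeomorphic_map X (pullback_topology (range g) (the_inv g) X) g"
proof -
  have gi: "the_inv g (g x) = x" for x by (rule the_inv_f_f[OF assms])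
  have "homeomorphic_maps X (pullback_topology (range g) (the_inv g) X) g (the_inv g)"
    unfolding homeomorphic_maps_def
  proof (intro conjI)
    show "continuous_map X (pullback_topology (range g) (the_inv g) X) g"
      by (rule continuous_map_pullback') (auto simp: o_def gi)
    show "continuous_map (pullback_topology (range g) (the_inv g) X) X (the_inv g)"
      using continuous_map_pullback[OF continuous_map_id, where f = "the_inv g" and A = "range g"]
      by (simp add: o_def)
  qed (auto simp: gi topspace_pullback_topology)
  then show ?thesis by (rule homeomorphic_maps_imp_map)
qed

lemma countably_pracompact_homeomorphic_image:
  assumes g: "homeomorphic_map X Y g" and X: "countably_pracompact X"
  shows "countably_pracompact Y"
proof -
  obtain A where A: "A \<subseteq> topspace X" "X closure_of A = topspace X"
      and acc: "\<And>B. \<lbrakk>B \<subseteq> A; infinite B\<rbrakk> \<Longrightarrow> X derived_set_of B \<noteq> {}"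
    using X unfolding countably_pracompact_def by metis
  have image: "g ` topspace X = topspace Y" using g by (rule homeomorphic_imp_surjective_map)
  show ?thesis
    unfolding countably_pracompact_def
  proof (intro exI[of _ "g ` A"] conjI allI impI)
    show "g ` A \<subseteq> topspace Y" using A(1) image by blast
    show "Y closure_of g ` A = topspace Y"
      using homeomorphic_map_closure_of[OF g A(1)] A(2) image by simp
    fix B assume B: "B \<subseteq> g ` A \<and> infinite B"
    then obtain B' where B': "B' \<subseteq> A" "B = g ` B'" by (meson subset_imageE)
    with B have "infinite B'" by auto
    then have "X derived_set_of B' \<noteq> {}" using acc B'(1) by blast
    then show "Y derived_set_of B \<noteq> {}"
      using homeomorphic_map_derived_set_of[OF g, of B'] A(1) B' by simp
  qed
qed

lemma topological_semigroup_inj_image: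
  fixes X :: "'a topology" and g :: "'a \<Rightarrow> 'b" and m :: "'a \<Rightarrow> 'a \<Rightarrow> 'a"
  assumes "inj g" and X: "topological_semigroup X m"
  shows "topological_semigroup (pullback_topology (range g) (the_inv g) X)
           (\<lambda>x y. g (m (the_inv g x) (the_inv g y)))"
    (is "topological_semigroup ?Y ?m")
proof -
  have gi: "the_inv g (g x) = x" for x by (rule the_inv_f_f[OF assms(1)])
  have g: "homeomorphic_map X ?Y g" using assms(1) by (rule homeomorphic_map_the_inv)
  then have top: "topspace ?Y = g ` topspace X" by (simp add: homeomorphic_imp_surjective_map)
  have "Hausdorff_space ?Y"
    using X homeomorphic_Hausdorff_space[OF homeomorphic_map_imp_homeomorphic_space[OF g]]
    by (simp add: topological_semigroup_def)
  moreover have inv: "continuous_map ?Y X (the_inv g)"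
    using continuous_map_pullback[OF continuous_map_id, where f = "the_inv g" and A = "range g"]
      by (simp add: o_def)
  have "continuous_map (prod_topology ?Y ?Y) (prod_topology X X) (\<lambda>(x, y). (the_inv g x, the_inv g y))"
    using inv by (simp add: continuous_map_prod_top)
  then have "continuous_map (prod_topology ?Y ?Y) X ((\<lambda>(x, y). m x y) \<circ> (\<lambda>(x, y). (the_inv g x, the_inv g y)))"
    using X unfolding topological_semigroup_def by (blast intro: continuous_map_compose)
  then have "continuous_map (prod_topology ?Y ?Y) ?Y
      (g \<circ> ((\<lambda>(x, y). m x y) \<circ> (\<lambda>(x, y). (the_inv g x, the_inv g y))))"
    using homeomorphic_imp_continuous_map[OF g] by (rule continuous_map_compose)
  then have "continuous_map (prod_topology ?Y ?Y) ?Y (\<lambda>(x, y). ?m x y)"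
    by (simp add: o_def case_prod_unfold)
  ultimately show ?thesis
    using X unfolding topological_semigroup_def top by (auto simp: gi)
qed

text \<open>A function is coded by its graph: a point of the graph amounts to three reals, hence to
  a set of naturals.\<close>

lemma inj_functions_to_sets:
  obtains g :: "bicyclic + (real \<Rightarrow> complex) \<Rightarrow> nat set set set" where "inj g"
proof -
  have "(UNIV :: real set) \<approx> (UNIV :: nat set set)"
    by (rule eqpoll_sym) (rule nat_sets_eqpoll_reals)
  then obtain \<rho> :: "real \<Rightarrow> nat set" where \<rho>: "inj \<rho>"
    unfolding eqpoll_def bij_betw_def by blast
  \<comment> \<open>The tags 0, 1, 2 keep the codes of the three reals apart.\<close>
  define \<psi> :: "real \<Rightarrow> complex \<Rightarrow> nat set" where
    "\<psi> x w = to_nat ` ({0 :: nat} \<times> \<rho> x \<union> {1} \<times> \<rho> (Re w) \<union> {2} \<times> \<rho> (Im w))" for x w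
  have \<psi>: "x = x' \<and> w = w'" if "\<psi> x w = \<psi> x' w'" for x x' w w'
  proof -
    define D where "D x w = {0 :: nat} \<times> \<rho> x \<union> {1} \<times> \<rho> (Re w) \<union> {2} \<times> \<rho> (Im w)" for x w
    have D: "{b. (0, b) \<in> D x w} = \<rho> x" "{b. (1, b) \<in> D x w} = \<rho> (Re w)"
        "{b. (2, b) \<in> D x w} = \<rho> (Im w)" for x w
      by (auto simp: D_def)
    have "D x w = D x' w'"
      using that unfolding \<psi>_def D_def by (simp only: inj_image_eq_iff[OF inj_to_nat])
    then have "\<rho> x = \<rho> x'" "\<rho> (Re w) = \<rho> (Re w')" "\<rho> (Im w) = \<rho> (Im w')"
      using D by metis+
    then show ?thesis using injD[OF \<rho>] by (blast intro: complex_eqI)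
  qed
  define g :: "bicyclic + (real \<Rightarrow> complex) \<Rightarrow> nat set set set" where
    \<comment> \<open>Bicyclic elements go to two-element sets and functions to singletons, so the
      two images are disjoint.\<close>
    "g = case_sum (\<lambda>c. {{}, {{to_nat c}}}) (\<lambda>t. {range (\<lambda>x. \<psi> x (t x))})"
  have "s = t" if "range (\<lambda>x. \<psi> x (s x)) = range (\<lambda>x. \<psi> x (t x))" for s t
  proof
    fix x
    have "\<psi> x (s x) \<in> range (\<lambda>x. \<psi> x (t x))" using that by blast
    then show "s x = t x" using \<psi> by blast
  qed
  then have "inj g"
    unfolding g_def inj_def by (auto split: sum.split simp: doubleton_eq_iff)
  then show thesis by (rule that)
qed

section \<open>The embedding\<close>

lemma Hausdorff_space_fun: "Hausdorff_space (euclidean :: ('a \<Rightarrow> 'b :: metric_space) topology)"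
  by (simp add: Hausdorff_space_product_topology flip: euclidean_product_topology)

lemma completely_regular_space_fun:
  "completely_regular_space (euclidean :: ('a \<Rightarrow> 'b :: metric_space) topology)"
  by (simp add: completely_regular_space_product_topology metrizable_imp_completely_regular_space
      metrizable_space_euclidean flip: euclidean_product_topology)

lemma continuous_on_fun_mult:
  "continuous_on S (\<lambda>(s, t). \<lambda>\<theta>. s \<theta> * t \<theta>)"
  for S :: "(('a \<Rightarrow> 'b :: real_normed_algebra) \<times> ('a \<Rightarrow> 'b)) set"
  unfolding case_prod_beta
proof (intro continuous_on_coordinatewise_then_product continuous_on_mult)
  fix \<theta>
  show "continuous_on S (\<lambda>p. fst p \<theta>)" "continuous_on S (\<lambda>p. snd p \<theta>)"
    by (rule continuous_on_product_then_coordinatewise; intro continuous_intros)+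
qed

text \<open>Joint continuity extends closure under products from the characters to their
  limits.\<close>

lemma closure_range_chi_mult:
  assumes "s \<in> closure (range chi)" "t \<in> closure (range chi)"
  shows "(\<lambda>\<theta>. s \<theta> * t \<theta>) \<in> closure (range chi)"
proof -
  have "(\<lambda>(s, t). \<lambda>\<theta>. s \<theta> * t \<theta>) ` (range chi \<times> range chi) \<subseteq> closure (range chi)"
    using closure_subset[of "range chi"] by (auto simp flip: chi_add)
  then have "(\<lambda>(s, t). \<lambda>\<theta>. s \<theta> * t \<theta>) ` closure (range chi \<times> range chi) \<subseteq> closure (range chi)"
    by (intro image_closure_subset continuous_on_fun_mult) auto
  then show ?thesis using assms unfolding closure_Times by fast
qed

lemma bicyclic_extension_exists:
  "\<exists>T. bicyclic_extension euclidean (\<lambda>s t \<theta>. s \<theta> * t \<theta>) chi T"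
proof -
  obtain f where f: "(\<forall>B. infinite B \<longrightarrow> f B \<in> euclidean derived_set_of (chi ` B)) \<and>
     (\<forall>l z. l \<noteq> [] \<longrightarrow> (\<forall>B\<in>set l. infinite B) \<longrightarrow> (\<lambda>\<theta>. prod_list (map (\<lambda>B. f B \<theta>) l)) \<noteq> chi z)"
    using independent_accumulation_points ..
  note acc = f[THEN conjunct1, rule_format] and indep = f[THEN conjunct2, rule_format]
  define Pr where "Pr l = (\<lambda>\<theta>. prod_list (map (\<lambda>B. f B \<theta>) l))" for l
  \<comment> \<open>The ideal generated by the chosen points in the semigroup that they and the
    characters generate; the empty list would add the characters themselves.\<close>
  define T where "T = {(\<lambda>\<theta>. chi z \<theta> * Pr l \<theta>) |z l. l \<noteq> [] \<and> (\<forall>B\<in>set l. infinite B)}"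
  have f_closure: "f B \<in> closure (range chi)" if "infinite B" for B
    using acc[OF that] derived_set_of_mono[of "chi ` B" "range chi" euclidean]
      derived_set_of_subset_closure_of[of euclidean "range chi"] by auto
  have chi_closure: "chi z \<in> closure (range chi)" for z
    by (rule subsetD[OF closure_subset]) simp
  have Pr_closure: "Pr l \<in> closure (range chi)" if "\<forall>B\<in>set l. infinite B" for l
    using that
  proof (induction l)
    case Nil
    have "Pr [] = chi 0" by (auto simp: Pr_def chi_def)
    then show ?case using chi_closure by simp
  next
    case (Cons B l)
    then have "(\<lambda>\<theta>. f B \<theta> * Pr l \<theta>) \<in> closure (range chi)"
      by (intro closure_range_chi_mult f_closure) auto
    then show ?case by (simp add: Pr_def)
  qed
  have "bicyclic_extension euclidean (\<lambda>s t \<theta>. s \<theta> * t \<theta>) chi T"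
  proof
    show "continuous_map (prod_topology euclidean euclidean) euclidean
        (\<lambda>(s, t). \<lambda>\<theta>. s \<theta> * t \<theta> :: complex)"
      by (simp add: continuous_on_fun_mult)
  next
    fix s t assume "s \<in> T" "t \<in> T"
    then obtain z w l k where "s = (\<lambda>\<theta>. chi z \<theta> * Pr l \<theta>)" "t = (\<lambda>\<theta>. chi w \<theta> * Pr k \<theta>)"
      "l \<noteq> []" "\<forall>B\<in>set l. infinite B" "\<forall>B\<in>set k. infinite B"
      unfolding T_def by blast
    then show "(\<lambda>\<theta>. s \<theta> * t \<theta>) \<in> T"
      unfolding T_def by (intro CollectI exI[of _ "z + w"] exI[of _ "l @ k"])
        (auto simp: chi_add Pr_def mult_ac)
  next
    fix t i assume "t \<in> T"
    then obtain z l where "t = (\<lambda>\<theta>. chi z \<theta> * Pr l \<theta>)" "l \<noteq> []" "\<forall>B\<in>set l. infinite B"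
      unfolding T_def by blast
    then show "(\<lambda>\<theta>. chi i \<theta> * t \<theta>) \<in> T"
      unfolding T_def by (intro CollectI exI[of _ "i + z"] exI[of _ l])
        (auto simp: chi_add mult_ac)
  next
    fix i show "chi i \<notin> T"
    proof
      assume "chi i \<in> T"
      then obtain z l where l: "l \<noteq> []" "\<forall>B\<in>set l. infinite B"
          and eq: "chi i = (\<lambda>\<theta>. chi z \<theta> * Pr l \<theta>)"
        unfolding T_def by blast
      \<comment> \<open>Cancelling the nowhere vanishing \<open>chi z\<close> leaves a relation
        excluded by \<open>indep\<close>.\<close>
      have "chi z \<theta> * chi (i - z) \<theta> = chi z \<theta> * Pr l \<theta>" for \<theta>
        using fun_cong[OF eq, of \<theta>] by (simp flip: chi_add)
      then have "Pr l = chi (i - z)" by (intro ext) simp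
      then show False using indep[of l "i - z"] l by (simp add: Pr_def)
    qed
  next
    show "T \<subseteq> euclidean closure_of range chi"
      using Pr_closure chi_closure closure_range_chi_mult by (auto simp: T_def)
  next
    fix B :: "int set" assume "infinite B"
    \<comment> \<open>Since \<open>chi 0\<close> is constantly 1, this element is \<open>f B\<close>
      itself.\<close>
    then have "(\<lambda>\<theta>. chi 0 \<theta> * Pr [B] \<theta>) \<in> T" unfolding T_def by fastforce
    moreover have "(\<lambda>\<theta>. chi 0 \<theta> * Pr [B] \<theta>) = f B" by (auto simp: Pr_def chi_def)
    ultimately show "T \<inter> euclidean derived_set_of (chi ` B) \<noteq> {}"
      using acc[OF \<open>infinite B\<close>] by auto
  qed (auto simp: inj_chi chi_add mult_ac Hausdorff_space_fun completely_regular_space_fun)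
  then show ?thesis by blast
qed

theorem theorem6p1:
  "\<exists>(X :: nat set set set topology) m h.
      topological_semigroup X m \<and> Tychonoff_space X \<and> countably_pracompact X \<and>
      inj h \<and> range h \<subseteq> topspace X \<and>
      (\<forall>x y. h (bicyclic_mult x y) = m (h x) (h y))"
proof -
  obtain T where "bicyclic_extension euclidean (\<lambda>s t \<theta>. s \<theta> * t \<theta>) chi T"
    using bicyclic_extension_exists by blast
  then interpret E: bicyclic_extension euclidean "\<lambda>s t \<theta>. s \<theta> * t \<theta>" chi T .
  obtain g :: "bicyclic + (real \<Rightarrow> complex) \<Rightarrow> nat set set set" where g: "inj g"
    by (rule inj_functions_to_sets)
  define X where "X = pullback_topology (range g) (the_inv g) E.xtop"
  have hom: "homeomorphic_map E.xtop X g"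
    unfolding X_def using g by (rule homeomorphic_map_the_inv)
  note space = homeomorphic_map_imp_homeomorphic_space[OF hom]
  show ?thesis
  proof (intro exI conjI allI)
    \<comment> \<open>The multiplication of the extension conjugated by \<open>g\<close>; the
      embedding is \<open>g \<circ> Inl\<close>.\<close>
    show "topological_semigroup X (\<lambda>x y. g (E.xmul (the_inv g x) (the_inv g y)))"
      unfolding X_def using g E.xtop_properties(1) by (rule topological_semigroup_inj_image)
    show "Tychonoff_space X"
      using E.xtop_properties(2) homeomorphic_Hausdorff_space[OF space]
        homeomorphic_completely_regular_space[OF space]
      by (simp add: Tychonoff_space_def)
    show "countably_pracompact X"
      using hom E.xtop_properties(3) by (rule countably_pracompact_homeomorphic_image)
    show "inj (g \<circ> Inl)" using g by (simp add: inj_compose)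
    show "range (g \<circ> Inl) \<subseteq> topspace X"
      using E.xtop_properties(4) homeomorphic_imp_surjective_map[OF hom] by auto
    show "(g \<circ> Inl) (bicyclic_mult x y) =
        g (E.xmul (the_inv g ((g \<circ> Inl) x)) (the_inv g ((g \<circ> Inl) y)))" for x y
      by (simp add: the_inv_f_f[OF g])
  qed
qed

end
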